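(* For each $(n,k)\in\{(34,16),(37,18),(39,18),(40,17),(40,18),(40,19)\}$, there exists a binary LCD $[n,k,8]$ code.
   Context: A binary $[n,k,d]$ code is a $k$-dimensional linear subspace $C$ of $\mathbb{F}_2^n$ whose minimum nonzero Hamming weight is $d$. It is LCD (Euclidean linear complementary dual) if $C\cap C^{\perp}=\{0\}$, where $C^{\perp}=\{y\in\mathbb{F}_2^n:\sum_i x_iy_i=0\text{ for all }x\in C\}$. *)

theory Defs
  imports
    "HOL-Library.Z2"
    "Jordan_Normal_Form.VS_Connect"
begin

text \<open>The field \<open>\<bbbF>\<^sub>2\<close> is the type \<^typ>\<open>bit\<close>, and \<open>\<bbbF>\<^sub>2\<^sup>n\<close> is the space of vectors
  \<^term>\<open>carrier_vec n :: bit vec set\<close>.\<close>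

definition hamming_weight :: "bit vec \<Rightarrow> nat" where
  "hamming_weight x = card {i. i < dim_vec x \<and> x $ i \<noteq> 0}"

definition min_weight :: "nat \<Rightarrow> bit vec set \<Rightarrow> nat \<Rightarrow> bool" where
  "min_weight n C d \<longleftrightarrow>
     (\<exists>x\<in>C. x \<noteq> 0\<^sub>v n \<and> hamming_weight x = d) \<and>
     (\<forall>x\<in>C. x \<noteq> 0\<^sub>v n \<longrightarrow> d \<le> hamming_weight x)"

text \<open>The dimension is that of \<open>C\<close> as a vector space in its own right, i.e. of the ambient
  space with its carrier restricted to \<open>C\<close>.\<close>

definition binary_code :: "nat \<Rightarrow> nat \<Rightarrow> nat \<Rightarrow> bit vec set \<Rightarrow> bool" where
  "binary_code n k d C \<longleftrightarrow>
     subspace class_ring C (module_vec TYPE(bit) n) \<and>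
     vectorspace.dim class_ring ((module_vec TYPE(bit) n)\<lparr>carrier := C\<rparr>) = k \<and>
     min_weight n C d"

definition dual_code :: "nat \<Rightarrow> bit vec set \<Rightarrow> bit vec set" where
  "dual_code n C = {y \<in> carrier_vec n. \<forall>x\<in>C. x \<bullet> y = 0}"

definition LCD_code :: "nat \<Rightarrow> bit vec set \<Rightarrow> bool" where
  "LCD_code n C \<longleftrightarrow> C \<inter> dual_code n C = {0\<^sub>v n}"

end

theory Submission
  imports Defs
begin

text \<open>
  Each code is given by a systematic generator matrix \<open>G = (I | A)\<close>, so its words are \<open>u @ v\<close> with
  \<open>v = u A\<close>. A nonzero word of weight below \<open>8\<close> has \<open>u\<close> or \<open>v\<close> of weight at most \<open>3\<close>, and since \<open>A\<close>
  has full rank, \<open>u\<close> can also be recovered linearly from \<open>v\<close>. Hence the minimum weight is decided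
  by fewer than \<open>3000\<close> sums of at most three rows instead of all \<open>2\<^sup>k\<close> words. The code is LCD
  because the Gram matrix \<open>G G\<^sup>T\<close> is invertible: if \<open>u G\<close> is orthogonal to all rows of \<open>G\<close>, then
  \<open>u (G G\<^sup>T) = 0\<close>, so \<open>u = 0\<close>.
\<close>

section \<open>Linear combinations of bit lists\<close>

text \<open>The result is cut to the shorter argument. This makes \<open>add\<close> associative and
  commutative on all lists, so the rearrangement laws carry no length hypotheses.\<close>

fun add :: "bit list \<Rightarrow> bit list \<Rightarrow> bit list" where
  "add (x # xs) (y # ys) = (x + y) # add xs ys"
| "add _ _ = []"

text \<open>The product of the row vector \<open>u\<close> with the matrix whose rows are
  \<open>R\<close>. The column count \<open>m\<close> is passed along because an empty sum must
  still have a length.\<close>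

fun lin_comb :: "nat \<Rightarrow> bit list list \<Rightarrow> bit list \<Rightarrow> bit list" where
  "lin_comb m (r # R) (c # u) = (if c = 0 then lin_comb m R u else add r (lin_comb m R u))"
| "lin_comb m _ _ = replicate m 0"

fun dot :: "bit list \<Rightarrow> bit list \<Rightarrow> bit" where
  "dot (x # xs) (y # ys) = x * y + dot xs ys"
| "dot _ _ = 0"

fun weight :: "bit list \<Rightarrow> nat" where
  "weight [] = 0"
| "weight (x # xs) = (if x = 0 then weight xs else Suc (weight xs))"

fun unit_rows :: "nat \<Rightarrow> bit list list" where
  "unit_rows 0 = []"
| "unit_rows (Suc k) = (1 # replicate k 0) # map ((#) 0) (unit_rows k)"

abbreviation zeros :: "nat \<Rightarrow> bit list" where
  "zeros m \<equiv> replicate m 0"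

abbreviation row_join :: "bit list list \<Rightarrow> bit list list \<Rightarrow> bit list list" where
  "row_join \<equiv> map2 (@)"

lemma length_add [simp]: "length (add xs ys) = min (length xs) (length ys)"
  by (induction xs ys rule: add.induct) auto

lemma add_nth: "i < length xs \<Longrightarrow> i < length ys \<Longrightarrow> add xs ys ! i = xs ! i + ys ! i"
proof (induction xs ys arbitrary: i rule: add.induct)
  case (1 x xs y ys)
  then show ?case by (cases i) auto
qed auto

lemma add_zeros [simp]:
  "length xs = m \<Longrightarrow> add xs (zeros m) = xs"
  "length xs = m \<Longrightarrow> add (zeros m) xs = xs"
  by (auto intro!: nth_equalityI simp: add_nth)

lemma add_assoc: "add (add xs ys) zs = add xs (add ys zs)"
  by (rule nth_equalityI) (auto simp: add_nth add.assoc)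

lemma add_commute: "add xs ys = add ys xs"
  by (rule nth_equalityI) (auto simp: add_nth add.commute)

lemma add_left_commute: "add xs (add ys zs) = add ys (add xs zs)"
  by (metis add_assoc add_commute)

lemmas add_ac = add_assoc add_commute add_left_commute

text \<open>Characteristic 2: the two copies of \<open>xs\<close> cancel. Equal lengths are assumed
  because truncation could otherwise shorten \<open>ys\<close>.\<close>

lemma add_self_left: "length ys = length xs \<Longrightarrow> add xs (add xs ys) = ys"
  by (rule nth_equalityI) (auto simp: add_nth)

lemma add_append:
  "length xs = length ys \<Longrightarrow> add (xs @ xs') (ys @ ys') = add xs ys @ add xs' ys'"
  by (induction xs ys rule: list_induct2) auto

section \<open>Row lists as matrices acting on row vectors\<close>

lemma length_lin_comb [simp]: "\<forall>r\<in>set R. length r = m \<Longrightarrow> length (lin_comb m R u) = m"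
  by (induction m R u rule: lin_comb.induct) auto

lemma lin_comb_zeros [simp]: "lin_comb m R (zeros k) = zeros m"
proof (induction R arbitrary: k)
  case (Cons r R)
  then show ?case by (cases k) auto
qed simp

lemma lin_comb_add:
  assumes "\<forall>r\<in>set R. length r = m" "length u = length R" "length w = length R"
  shows "lin_comb m R (add u w) = add (lin_comb m R u) (lin_comb m R w)"
  using assms
proof (induction R arbitrary: u w)
  case (Cons r R)
  then obtain c u' d w' where u: "u = c # u'" "w = d # w'"
    by (metis length_Suc_conv)
  have IH: "lin_comb m R (add u' w') = add (lin_comb m R u') (lin_comb m R w')"
    using Cons u by simp
  show ?case
    using Cons.prems unfolding u
    \<comment> \<open>If both coefficients are 1, then \<open>c + d = 0\<close> on the left, while
      the two copies of \<open>r\<close> on the right cancel.\<close>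
    by (cases c; cases d) (simp_all add: IH add_ac add_self_left)
qed simp

text \<open>Associativity of the matrix product, (u R) S = u (R S): the rows of R S are the images
  of the rows of \<open>R\<close> under \<open>S\<close>. It is what lets a certificate state a
  matrix identity by listing images of rows.\<close>

lemma lin_comb_lin_comb:
  assumes "\<forall>r\<in>set R. length r = length S" "\<forall>s\<in>set S. length s = p"
  shows "lin_comb p S (lin_comb (length S) R u) = lin_comb p (map (lin_comb p S) R) u"
  using assms
proof (induction "length S" R u rule: lin_comb.induct)
  case (1 r R c u)
  then show ?case by (cases c) (auto simp: lin_comb_add)
qed auto

lemma lin_comb_row_join:
  assumes "length P = length Q" "\<forall>r\<in>set P. length r = p"
  shows "lin_comb (p + q) (row_join P Q) u = lin_comb p P u @ lin_comb q Q u"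
  using assms
proof (induction P Q arbitrary: u rule: list_induct2)
  case (Cons r P s Q)
  then show ?case
    by (cases u) (auto simp: add_append replicate_add)
qed (auto simp: replicate_add)

lemma lin_comb_map_Cons_zero: "lin_comb (Suc m) (map ((#) 0) R) u = 0 # lin_comb m R u"
  by (induction m R u rule: lin_comb.induct) auto

lemma length_unit_rows [simp]: "length (unit_rows k) = k"
  by (induction k) auto

lemma length_in_unit_rows: "r \<in> set (unit_rows k) \<Longrightarrow> length r = k"
  by (induction k arbitrary: r) auto

lemma lin_comb_unit_rows: "length u = k \<Longrightarrow> lin_comb k (unit_rows k) u = u"
proof (induction k arbitrary: u)
  case (Suc k)
  then obtain c w where "u = c # w" "length w = k"
    by (metis length_Suc_conv)
  with Suc.IH show ?case
    by (cases c) (simp_all add: lin_comb_map_Cons_zero)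
qed simp

text \<open>Evaluates the right-hand side of A T = (0 | I) on a message.\<close>

lemma lin_comb_map_append_unit_rows:
  assumes "length u = k"
  shows "lin_comb (h + k) (map ((@) (zeros h)) (unit_rows k)) u = zeros h @ u"
proof -
  have eq: "map ((@) (zeros h)) (unit_rows k) = row_join (replicate k (zeros h)) (unit_rows k)"
    by (auto intro!: nth_equalityI)
  have "lin_comb h (replicate k (zeros h)) u = zeros h"
    using assms by (induction u arbitrary: k) auto
  then show ?thesis
    unfolding eq using assms by (subst lin_comb_row_join) (auto simp: lin_comb_unit_rows)
qed

text \<open>The coefficient vector is the unit vector at the first occurrence of
  \<open>r\<close>.\<close>

lemma row_in_lin_combs:
  assumes "r \<in> set R" "\<forall>r\<in>set R. length r = m"
  shows "\<exists>u. length u = length R \<and> lin_comb m R u = r"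
  using assms
proof (induction R)
  case (Cons s R)
  show ?case
  proof (cases "r = s")
    case True
    then show ?thesis
      using Cons.prems by (intro exI[of _ "1 # zeros (length R)"]) auto
  next
    case False
    then obtain u where "length u = length R" "lin_comb m R u = r"
      using Cons by auto
    then show ?thesis by (intro exI[of _ "0 # u"]) auto
  qed
qed simp

section \<open>The standard bilinear form and Gram matrices\<close>

lemma dot_zeros [simp]: "dot (zeros m) x = 0"
proof (induction m arbitrary: x)
  case (Suc m)
  then show ?case by (cases x) auto
qed simp

lemma dot_add:
  "length xs = length zs \<Longrightarrow> length ys = length zs \<Longrightarrow> dot (add xs ys) zs = dot xs zs + dot ys zs"
proof (induction zs arbitrary: xs ys)
  case (Cons z zs)
  then obtain x xs' y ys' where "xs = x # xs'" "ys = y # ys'"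
    by (metis length_Suc_conv)
  \<comment> \<open>Rewriting is restricted so that sums and products of bits stay ring expressions,
    to which distributivity applies, instead of becoming xor and conjunction.\<close>
  with Cons have "dot (add xs ys) (z # zs) = (x + y) * z + (dot xs' zs + dot ys' zs)"
    by (simp only: add.simps dot.simps Cons.IH length_Cons nat.inject)
  also have "\<dots> = (x * z + dot xs' zs) + (y * z + dot ys' zs)"
    by (simp only: distrib_right add.assoc add.left_commute)
  finally show ?case
    using \<open>xs = x # xs'\<close> \<open>ys = y # ys'\<close> by simp
qed simp

text \<open>This is u (G H^T) = (u G) H^T. With \<open>H = G\<close> it turns orthogonality of u G
  to every row of \<open>G\<close> into u (G G^T) = 0.\<close>

lemma lin_comb_gram:
  assumes "\<forall>g\<in>set G. length g = m" "\<forall>h\<in>set H. length h = m"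
  shows "lin_comb (length H) (map (\<lambda>g. map (dot g) H) G) u = map (dot (lin_comb m G u)) H"
  using assms
proof (induction m G u rule: lin_comb.induct)
  case (1 m g G c u)
  have "add (map (dot g) H) (map (dot (lin_comb m G u)) H) = map (dot (add g (lin_comb m G u))) H"
    using 1 by (auto intro!: nth_equalityI simp: add_nth dot_add)
  with 1 show ?case by auto
qed (auto intro!: nth_equalityI)

section \<open>Hamming weight of bit lists\<close>

lemma weight_append [simp]: "weight (xs @ ys) = weight xs + weight ys"
  by (induction xs) auto

lemma weight_eq_card: "weight xs = card {i. i < length xs \<and> xs ! i \<noteq> 0}"
proof -
  have "weight xs = length (filter (\<lambda>x. x \<noteq> 0) xs)"
    by (induction xs) auto
  then show ?thesis by (simp add: length_filter_conv_card)
qed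

section \<open>Enumeration of combinations of few rows\<close>

text \<open>Depth-first search through the sets of at most t rows, with \<open>x\<close> as the
  partial sum: each row is either skipped or added at the cost of one unit of the budget. Every set
  is reached at exactly one leaf, and partial sums are shared.\<close>

fun all_combs :: "(bit list \<Rightarrow> bool) \<Rightarrow> nat \<Rightarrow> bit list \<Rightarrow> bit list list \<Rightarrow> bool" where
  "all_combs P 0 x R \<longleftrightarrow> P x"
| "all_combs P (Suc t) x [] \<longleftrightarrow> P x"
| "all_combs P (Suc t) x (r # R) \<longleftrightarrow> all_combs P (Suc t) x R \<and> all_combs P t (add r x) R"

lemma lin_comb_weight_0: "weight u = 0 \<Longrightarrow> lin_comb m R u = zeros m"
  by (induction m R u rule: lin_comb.induct) (auto split: if_splits)

text \<open>Stated for an arbitrary partial sum \<open>x\<close> so that the induction follows the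
  search; the leading coefficient of \<open>u\<close> selects the branch.\<close>

lemma all_combs_add:
  assumes "all_combs P t x R" "length u = length R" "weight u \<le> t"
    "\<forall>r\<in>set R. length r = length x"
  shows "P (add x (lin_comb (length x) R u))"
  using assms
proof (induction P t x R arbitrary: u rule: all_combs.induct)
  case (1 P x R)
  then show ?case by (simp add: lin_comb_weight_0)
next
  case (2 P t x)
  then show ?case by simp
next
  case (3 P t x r R)
  then obtain c w where u: "u = c # w" "length w = length R"
    by (metis length_Suc_conv)
  show ?case
  proof (cases "c = 0")
    case True
    then show ?thesis using 3 u by simp
  next
    case False
    have len: "length (add r x) = length x" using "3.prems" by simp
    \<comment> \<open>Choosing \<open>r\<close> spends one unit of the budget, and removing the
      leading 1 from \<open>u\<close> lowers its weight by one, so the bound on the weight is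
      kept.\<close>
    have "P (add (add r x) (lin_comb (length (add r x)) R w))"
      using "3.prems" u False len by (intro "3.IH"(2)) auto
    then show ?thesis
      using u False len by (simp add: add_ac)
  qed
qed

lemma all_combs:
  assumes "all_combs P t (zeros m) R" "length u = length R" "weight u \<le> t"
    "\<forall>r\<in>set R. length r = m"
  shows "P (lin_comb m R u)"
  using all_combs_add[OF assms(1-3)] assms(4) by simp

text \<open>The default code equation for addition of bits goes through bit operations, which is far too
  slow for evaluation by rewriting; these equations only match on the constructors 0 and 1.\<close>

lemma add_code [code]:
  "add (0 # xs) (y # ys) = y # add xs ys"
  "add (1 # xs) (0 # ys) = 1 # add xs ys"
  "add (1 # xs) (1 # ys) = 0 # add xs ys"
  "add [] ys = []"
  "add xs [] = []"
  by (cases xs; simp)+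

lemma lin_comb_code [code]:
  "lin_comb m (r # R) (0 # u) = lin_comb m R u"
  "lin_comb m (r # R) (1 # u) = add r (lin_comb m R u)"
  "lin_comb m [] u = zeros m"
  "lin_comb m R [] = zeros m"
  by (cases R; simp)+

lemma dot_code [code]:
  "dot (0 # xs) (y # ys) = dot xs ys"
  "dot (1 # xs) (0 # ys) = dot xs ys"
  "dot (1 # xs) (1 # ys) = (case dot xs ys of 0 \<Rightarrow> 1 | 1 \<Rightarrow> 0)"
  "dot [] ys = 0"
  "dot xs [] = 0"
  by (cases xs; simp split: bit.split)+

lemma weight_code [code]:
  "weight (0 # xs) = weight xs"
  "weight (1 # xs) = Suc (weight xs)"
  "weight [] = 0"
  by simp_all

text \<open>A threshold test for the weight that stops at the d-th nonzero entry, so the weight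
  itself is never computed during the search.\<close>

fun heavy :: "nat \<Rightarrow> bit list \<Rightarrow> bool" where
  "heavy 0 xs \<longleftrightarrow> True"
| "heavy (Suc d) [] \<longleftrightarrow> False"
| "heavy (Suc d) (x # xs) \<longleftrightarrow> (if x = 0 then heavy (Suc d) xs else heavy d xs)"

lemma heavy_code [code]:
  "heavy (Suc d) (0 # xs) = heavy (Suc d) xs"
  "heavy (Suc d) (1 # xs) = heavy d xs"
  "heavy (Suc d) [] = False"
  "heavy 0 xs = True"
  by simp_all

lemma heavy_iff: "heavy d xs \<longleftrightarrow> d \<le> weight xs"
  by (induction d xs rule: heavy.induct) auto

text \<open>In a word with \<open>h\<close> leading coordinates, those are a syndrome: if one of them is
  nonzero, the rest is not a codeword and its weight is irrelevant.\<close>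

fun admissible :: "nat \<Rightarrow> nat \<Rightarrow> bit list \<Rightarrow> bool" where
  "admissible d (Suc h) (x # xs) \<longleftrightarrow> x = 1 \<or> admissible d h xs"
| "admissible d _ xs \<longleftrightarrow> heavy d xs \<or> \<not> heavy 1 xs"

lemma admissible_code [code]:
  "admissible d (Suc h) (0 # xs) = admissible d h xs"
  "admissible d (Suc h) (1 # xs) = True"
  "admissible d (Suc h) [] = (heavy d [] \<or> \<not> heavy 1 [])"
  "admissible d 0 xs = (heavy d xs \<or> \<not> heavy 1 xs)"
  by simp_all

text \<open>With zero syndrome only the weight test remains. Weight 0 has to be accepted because the
  search also visits the empty sum; \<open>h = 0\<close> gives the plain test for sums of generator
  rows.\<close>

lemma admissible_zeros_append:
  "admissible d h (zeros h @ xs) \<longleftrightarrow> d \<le> weight xs \<or> weight xs = 0"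
  by (induction h) (auto simp: heavy_iff simp del: heavy.simps One_nat_def)

section \<open>Certificates for systematic LCD codes\<close>

definition systematic :: "nat \<Rightarrow> bit list list \<Rightarrow> bit list list" where
  "systematic k A = row_join (unit_rows k) A"

definition all_rows :: "nat \<Rightarrow> nat \<Rightarrow> bit list list \<Rightarrow> bool" where
  "all_rows k m R \<longleftrightarrow> length R = k \<and> list_all (\<lambda>r. length r = m) R"

text \<open>\<open>T\<close> satisfies \<open>A T = (0 | I)\<close>: applied to \<open>v\<close> it yields \<open>h\<close> syndrome bits followed by the
  message \<open>u\<close>. \<open>N\<close> is the inverse of the Gram matrix.\<close>

definition certificate ::
    "nat \<Rightarrow> nat \<Rightarrow> nat \<Rightarrow> bit list list \<Rightarrow> bit list list \<Rightarrow> bit list list \<Rightarrow> bool" where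
  "certificate k h d A T N \<longleftrightarrow>
     all_rows k (h + k) A \<and> all_rows (h + k) (h + k) T \<and> all_rows k k N \<and>
     map (lin_comb (h + k) T) A = map ((@) (zeros h)) (unit_rows k) \<and>
     (let G = systematic k A in
       map (lin_comb k N) (map (\<lambda>g. map (dot g) G) G) = unit_rows k \<and>
       list_ex (\<lambda>g. weight g = d) G \<and>
       all_combs (admissible d 0) ((d - 1) div 2) (zeros (k + (h + k))) G) \<and>
     all_combs (admissible d h) ((d - 1) div 2) (zeros ((h + k) + (h + k)))
       (row_join T (unit_rows (h + k)))"

lemma length_in_row_join:
  assumes "\<forall>r\<in>set P. length r = p" "\<forall>r\<in>set Q. length r = q" "r \<in> set (row_join P Q)"
  shows "length r = p + q"
proof -
  obtain x y where "(x, y) \<in> set (zip P Q)" "r = x @ y"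
    using assms(3) by auto
  then show ?thesis
    using assms(1,2) set_zip_leftD[of x y] set_zip_rightD[of x y] by auto
qed

lemma weight_eq_0_iff: "weight xs = 0 \<longleftrightarrow> xs = zeros (length xs)"
  by (induction xs) auto

abbreviation codeword :: "nat \<Rightarrow> nat \<Rightarrow> bit list list \<Rightarrow> bit list \<Rightarrow> bit list" where
  "codeword k h A u \<equiv> lin_comb (k + (h + k)) (systematic k A) u"

context
  fixes k h d :: nat and A T N :: "bit list list"
  assumes cert: "certificate k h d A T N"
begin

lemma lengths:
  "length A = k" "\<forall>r\<in>set A. length r = h + k"
  "length T = h + k" "\<forall>r\<in>set T. length r = h + k"
  "length N = k" "\<forall>r\<in>set N. length r = k"
  "length (systematic k A) = k" "\<forall>r\<in>set (systematic k A). length r = k + (h + k)"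
  using cert length_in_row_join[of "unit_rows k" k A "h + k"]
  by (auto simp: certificate_def all_rows_def list_all_iff systematic_def length_in_unit_rows)

lemma codeword_eq: "length u = k \<Longrightarrow> codeword k h A u = u @ lin_comb (h + k) A u"
  unfolding systematic_def
  using lengths by (subst lin_comb_row_join) (auto simp: length_in_unit_rows lin_comb_unit_rows)

text \<open>Multiply A T = (0 | I) by \<open>u\<close> from the left: the redundancy part alone
  determines the message.\<close>

lemma decode: "length u = k \<Longrightarrow> lin_comb (h + k) T (lin_comb (h + k) A u) = zeros h @ u"
  using lin_comb_lin_comb[of A T "h + k" u] lengths cert
  by (simp add: certificate_def lin_comb_map_append_unit_rows)

text \<open>In a word (u | v) of weight below \<open>d\<close> one half is light. A light
  \<open>u\<close> makes the word a sum of few rows of (I | A), a light \<open>v\<close> makes (0 |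
  u | v) a sum of few rows of (T | I). Both kinds of sums are covered by the certificate.\<close>

lemma weight_codeword:
  assumes u: "length u = k" "u \<noteq> zeros k"
  shows "d \<le> weight (codeword k h A u)"
proof (rule ccontr)
  define v where "v = lin_comb (h + k) A u"
  have v: "length v = h + k" "codeword k h A u = u @ v"
    using lengths u by (auto simp: v_def codeword_eq)
  assume "\<not> d \<le> weight (codeword k h A u)"
  then have light: "weight u + weight v < d"
    using v by simp
  \<comment> \<open>Two naturals with sum at most \<open>d - 1\<close> cannot both exceed its half,
    rounded down; for \<open>d = 8\<close> the bound is 3.\<close>
  then consider "weight u \<le> (d - 1) div 2" | "weight v \<le> (d - 1) div 2"
    by linarith
  then have "d \<le> weight (u @ v) \<or> weight (u @ v) = 0"
  proof cases
    case 1
    have "admissible d 0 (codeword k h A u)"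
      using cert 1 lengths u
      by (intro all_combs[where P = "admissible d 0"])
        (auto simp: certificate_def Let_def)
    then show ?thesis
      using admissible_zeros_append[of d 0] v by simp
  next
    case 2
    have len: "\<forall>r\<in>set (row_join T (unit_rows (h + k))). length r = (h + k) + (h + k)"
      using lengths length_in_row_join[of T "h + k" "unit_rows (h + k)" "h + k"]
      by (auto simp: length_in_unit_rows)
    have "admissible d h (lin_comb ((h + k) + (h + k)) (row_join T (unit_rows (h + k))) v)"
      using cert 2 lengths v len
      by (intro all_combs[where P = "admissible d h"]) (auto simp: certificate_def Let_def)
    \<comment> \<open>Since \<open>v\<close> is the redundancy of \<open>u\<close>, its image under
      \<open>T\<close> is (0 | u). The syndrome vanishes, so the test really bounds the weight of (u
      | v).\<close>
    also have "lin_comb ((h + k) + (h + k)) (row_join T (unit_rows (h + k))) v = zeros h @ (u @ v)"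
      using lengths v decode[OF u(1)]
      by (subst lin_comb_row_join) (auto simp: lin_comb_unit_rows v_def)
    finally show ?thesis
      by (simp only: admissible_zeros_append)
  qed
  \<comment> \<open>This excludes the zero word, the other alternative left open by the
    test.\<close>
  moreover have "weight u \<noteq> 0"
    using u by (simp add: weight_eq_0_iff)
  ultimately show False
    using light by simp
qed

text \<open>Orthogonality to the rows gives u (G G^T) = 0, and multiplying by \<open>N\<close> on
  the right returns \<open>u\<close>.\<close>

lemma self_orthogonal_codeword:
  assumes u: "length u = k" and orth: "\<forall>w. length w = k \<longrightarrow> dot (codeword k h A u) (codeword k h A w) = 0"
  shows "u = zeros k"
proof -
  let ?G = "systematic k A"
  \<comment> \<open>Each row of the generator matrix is itself a codeword.\<close>
  have "dot (codeword k h A u) g = 0" if "g \<in> set ?G" for g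
    using row_in_lin_combs[OF that lengths(8)] lengths orth by auto
  then have "map (dot (codeword k h A u)) ?G = zeros k"
    using lengths by (auto intro!: nth_equalityI)
  moreover have "lin_comb k (map (\<lambda>g. map (dot g) ?G) ?G) u = map (dot (codeword k h A u)) ?G"
    using lin_comb_gram[OF lengths(8) lengths(8), of u] lengths by simp
  moreover have "lin_comb k N (lin_comb k (map (\<lambda>g. map (dot g) ?G) ?G) u) = u"
    using lin_comb_lin_comb[of "map (\<lambda>g. map (dot g) ?G) ?G" N k u] lengths cert u
    by (simp add: certificate_def Let_def lin_comb_unit_rows)
  ultimately show ?thesis by simp
qed

end

section \<open>From bit lists to vectors\<close>

lemma vec_of_list_add:
  "length xs = length ys \<Longrightarrow> vec_of_list (add xs ys) = vec_of_list xs + vec_of_list ys"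
  by (intro eq_vecI) (simp_all add: vec_of_list_index add_nth del: add_bit_eq_xor)

lemma vec_of_list_zeros: "vec_of_list (zeros m) = 0\<^sub>v m"
  by (intro eq_vecI) (simp_all add: vec_of_list_index)

lemma hamming_weight_vec_of_list: "hamming_weight (vec_of_list xs) = weight xs"
  unfolding hamming_weight_def weight_eq_card by (simp add: vec_of_list_index)

lemma hamming_weight_zero: "hamming_weight (0\<^sub>v n) = 0"
  by (auto simp: hamming_weight_def)

lemma scalar_prod_vec_of_list:
  "length xs = length ys \<Longrightarrow> vec_of_list xs \<bullet> vec_of_list ys = dot xs ys"
proof (induction xs ys rule: list_induct2)
  case Nil
  then show ?case by (simp add: scalar_prod_def)
next
  case (Cons x xs y ys)
  then show ?case
    by (simp del: add_bit_eq_xor mult_bit_eq_and)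
qed

lemma list_of_vec_add:
  "dim_vec x = dim_vec y \<Longrightarrow> list_of_vec (x + y) = add (list_of_vec x) (list_of_vec y)"
  by (intro nth_equalityI) (simp_all add: add_nth list_of_vec_index)

lemma list_of_vec_zero: "list_of_vec (0\<^sub>v m) = zeros m"
  by (intro nth_equalityI) (simp_all add: list_of_vec_index)

text \<open>Rank-nullity with trivial kernel. The dimension is taken in the image as a space of its
  own, the form that \<open>binary_code\<close> asks for.\<close>

lemma linear_image_subspace_dim:
  fixes f :: "'a :: field vec \<Rightarrow> 'a vec"
  assumes carrier: "\<And>x. x \<in> carrier_vec k \<Longrightarrow> f x \<in> carrier_vec n"
    and add: "\<And>x y. x \<in> carrier_vec k \<Longrightarrow> y \<in> carrier_vec k \<Longrightarrow> f (x + y) = f x + f y"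
    and smult: "\<And>c x. x \<in> carrier_vec k \<Longrightarrow> f (c \<cdot>\<^sub>v x) = c \<cdot>\<^sub>v f x"
    and inj: "inj_on f (carrier_vec k)"
  defines "C \<equiv> f ` carrier_vec k"
  shows "subspace class_ring C (module_vec TYPE('a) n)"
    and "vectorspace.dim class_ring ((module_vec TYPE('a) n)\<lparr>carrier := C\<rparr>) = k"
proof -
  let ?V = "\<lambda>n. module_vec TYPE('a) n"
  have "f \<in> LinearCombinations.module_hom class_ring (?V k) (?V n)"
    using carrier add smult by (simp add: LinearCombinations.module_hom_def module_vec_simps)
  then interpret f: linear_map class_ring "?V k" "?V n" f
    using vec_vs[of k, where ?'a = 'a] vec_vs[of n, where ?'a = 'a]
    by (intro linear_map.intro mod_hom.intro mod_hom_axioms.intro) (simp_all add: vectorspace_def)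
  have im: "f.imT = C"
    by (simp add: C_def f.im_def module_vec_simps)
  show "subspace class_ring C (?V n)"
    using f.imT_is_subspace im by simp
  have "f.V.fin_dim" "f.V.dim = k"
    using vec_space.fin_dim vec_space.dim_is_n by blast+
  moreover have "inj_on f (carrier (?V k))"
    using inj by (simp add: module_vec_simps)
  ultimately show "vectorspace.dim class_ring ((?V n)\<lparr>carrier := C\<rparr>) = k"
    using f.rank_nullity f.inj_imp_dim_ker0 im by simp
qed

lemma certificate_imp_LCD_code:
  assumes cert: "certificate k h d A T N" and d: "d > 0"
  shows "\<exists>C. binary_code (k + (h + k)) k d C \<and> LCD_code (k + (h + k)) C"
proof -
  define n where "n = k + (h + k)"
  define G where "G = systematic k A"
  note lens = lengths[OF cert, folded G_def n_def]
  define \<phi> where "\<phi> x = vec_of_list (lin_comb n G (list_of_vec x))" for x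
  define C where "C = \<phi> ` carrier_vec k"
  \<comment> \<open>Two views of the code: as the image of \<open>\<phi>\<close> for subspace and
    dimension, as a set of encoded lists for weights and orthogonality.\<close>
  have C: "C = {vec_of_list (lin_comb n G u) | u. length u = k}"
  proof (intro equalityI subsetI)
    fix y assume "y \<in> C"
    then obtain x where "x \<in> carrier_vec k" "y = \<phi> x"
      unfolding C_def by blast
    then show "y \<in> {vec_of_list (lin_comb n G u) | u. length u = k}"
      by (intro CollectI exI[of _ "list_of_vec x"]) (simp add: \<phi>_def)
  next
    fix y assume "y \<in> {vec_of_list (lin_comb n G u) | u. length u = k}"
    then obtain u where u: "length u = k" "y = vec_of_list (lin_comb n G u)"
      by blast
    then have "y = \<phi> (vec_of_list u)" "vec_of_list u \<in> carrier_vec k"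
      by (simp_all add: \<phi>_def list_vec carrier_dim_vec)
    then show "y \<in> C"
      unfolding C_def by blast
  qed
  have \<phi>_add: "\<phi> (x + y) = \<phi> x + \<phi> y" if "x \<in> carrier_vec k" "y \<in> carrier_vec k" for x y
    using that lens by (simp add: \<phi>_def list_of_vec_add lin_comb_add vec_of_list_add)
  have \<phi>_carrier: "\<phi> x \<in> carrier_vec n" for x
    using lens by (simp add: \<phi>_def carrier_dim_vec)
  have \<phi>_smult: "\<phi> (c \<cdot>\<^sub>v x) = c \<cdot>\<^sub>v \<phi> x" if "x \<in> carrier_vec k" for c x
  \<comment> \<open>The only scalars are 0 and 1; the zero case uses that the zero message is
    encoded as the zero word.\<close>
  proof (cases "c = 0")
    case True
    have "c \<cdot>\<^sub>v x = 0\<^sub>v k" "c \<cdot>\<^sub>v \<phi> x = 0\<^sub>v n"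
      using that True \<phi>_carrier[of x] by auto
    then show ?thesis
      by (simp add: \<phi>_def list_of_vec_zero vec_of_list_zeros)
  next
    case False
    then show ?thesis by simp
  qed
  have inj: "inj_on \<phi> (carrier_vec k)"
  proof (rule inj_onI)
    fix x y assume xy: "x \<in> carrier_vec k" "y \<in> carrier_vec k" "\<phi> x = \<phi> y"
    then have "lin_comb n G (list_of_vec x) = lin_comb n G (list_of_vec y)"
      unfolding \<phi>_def by (metis list_vec)
    then have "list_of_vec x = list_of_vec y"
      \<comment> \<open>The encoding is systematic, so the first \<open>k\<close> coordinates of a
        codeword are its message.\<close>
      using xy codeword_eq[OF cert, folded G_def n_def] by simp
    then show "x = y" by (metis vec_list)
  qed
  have "subspace class_ring C (module_vec TYPE(bit) n)"
    "vectorspace.dim class_ring ((module_vec TYPE(bit) n)\<lparr>carrier := C\<rparr>) = k"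
    unfolding C_def
    using linear_image_subspace_dim[of k \<phi> n, OF \<phi>_carrier \<phi>_add \<phi>_smult inj] by simp_all
  moreover have "min_weight n C d"
    unfolding min_weight_def
  proof (intro conjI ballI impI)
    \<comment> \<open>The minimum is attained already by a row of the generator matrix;
      \<open>d > 0\<close> makes that row nonzero.\<close>
    have "\<exists>g\<in>set G. weight g = d"
      using cert by (auto simp: certificate_def Let_def list_ex_iff G_def)
    then obtain u where u: "length u = k" "weight (lin_comb n G u) = d"
      using row_in_lin_combs[OF _ lens(8)] lens(7) by metis
    have "vec_of_list (lin_comb n G u) \<noteq> 0\<^sub>v n"
      using u d hamming_weight_vec_of_list[of "lin_comb n G u"] hamming_weight_zero[of n] by auto
    then show "\<exists>x\<in>C. x \<noteq> 0\<^sub>v n \<and> hamming_weight x = d"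
      using u C hamming_weight_vec_of_list by blast
  next
    fix x assume "x \<in> C" "x \<noteq> 0\<^sub>v n"
    then obtain u where u: "length u = k" "x = vec_of_list (lin_comb n G u)" "u \<noteq> zeros k"
      using C vec_of_list_zeros by force
    then show "d \<le> hamming_weight x"
      using weight_codeword[OF cert, folded G_def n_def]
      by (simp add: hamming_weight_vec_of_list)
  qed
  moreover have "LCD_code n C"
    unfolding LCD_code_def
  proof (intro equalityI subsetI)
    fix x assume x: "x \<in> C \<inter> dual_code n C"
    then obtain u where u: "length u = k" "x = vec_of_list (lin_comb n G u)"
      using C by auto
    have "dot (lin_comb n G u) (lin_comb n G w) = 0" if w: "length w = k" for w
    proof -
      have "vec_of_list (lin_comb n G w) \<bullet> x = 0"
        using x w C by (auto simp: dual_code_def)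
      then have "x \<bullet> vec_of_list (lin_comb n G w) = 0"
        \<comment> \<open>\<open>dual_code\<close> puts the codeword on the left of the product,
          while the Gram argument needs \<open>x\<close> there.\<close>
        using lens u by (subst comm_scalar_prod[of _ n]) (auto simp: carrier_dim_vec)
      then show ?thesis
        using lens u by (simp add: scalar_prod_vec_of_list)
    qed
    then have "u = zeros k"
      using self_orthogonal_codeword[OF cert, folded G_def n_def] u by blast
    then show "x \<in> {0\<^sub>v n}"
      using u by (simp add: vec_of_list_zeros)
  next
    fix x :: "bit vec" assume x: "x \<in> {0\<^sub>v n}"
    have "0\<^sub>v n \<in> C"
      unfolding C using vec_of_list_zeros lin_comb_zeros[of n G k]
      by (intro CollectI exI[of _ "zeros k"]) simp
    then show "x \<in> C \<inter> dual_code n C"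
      using x \<phi>_carrier by (auto simp: dual_code_def C_def)
  qed
  ultimately show ?thesis
    unfolding binary_code_def n_def by blast
qed

section \<open>The six codes\<close>

text \<open>Up to a permutation of coordinates, the codes of length 40 are subcodes of a double circulant
  \<open>[40, 20]\<close> code and that of length 39 is a subcode of a shortening of it; the codes of lengths 37 and 34
  are obtained by shortening double circulant \<open>[38, 19, 8]\<close> and \<open>[36, 18, 8]\<close> codes at
  one and two coordinates.\<close>

definition redundancy_34_16 :: "bit list list" where
  "redundancy_34_16 =
    [[0,0,0,0,0,0,0,0,0,0,0,1,1,1,1,1,1,1],
     [1,0,1,0,0,1,0,0,0,1,0,1,1,0,1,1,1,0],
     [1,0,1,0,0,0,1,0,1,0,0,0,1,0,0,1,0,1],
     [1,0,0,1,0,1,0,1,0,1,1,1,0,0,0,0,0,0],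
     [0,1,0,1,1,1,1,0,1,1,0,1,0,1,1,0,0,1],
     [1,1,1,1,0,0,1,0,1,1,0,0,0,1,0,0,1,0],
     [0,1,1,0,1,1,1,0,1,0,1,1,0,0,1,1,0,1],
     [1,0,0,1,1,0,1,0,0,0,0,0,1,1,1,0,1,1],
     [1,0,0,1,1,1,1,0,1,1,1,1,1,0,1,1,0,1],
     [1,0,0,1,0,1,1,1,0,0,1,0,0,1,0,0,1,1],
     [1,1,0,1,0,0,0,1,0,1,0,1,1,0,0,1,1,0],
     [1,1,1,0,1,1,1,0,0,0,0,0,1,0,1,0,0,1],
     [1,1,0,0,1,1,0,0,0,1,0,0,1,1,0,1,1,0],
     [0,1,0,0,0,0,1,1,1,0,0,0,0,0,1,1,1,0],
     [1,1,0,0,1,1,1,1,1,1,1,0,0,1,0,1,0,0],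
     [1,1,1,0,1,0,1,1,0,0,1,1,0,0,1,0,0,0]]"

text \<open>The first two columns form a basis of the right kernel of A, the other sixteen a right
  inverse of A. The first two rows are unit vectors because the last sixteen columns of A are
  already invertible: the right inverse vanishes on the first two coordinates. The other decoders
  have the same shape, with \<open>h\<close> unit rows at the coordinates left out.\<close>

definition decoder_34_16 :: "bit list list" where
  "decoder_34_16 =
    [[1,0,0,0,0,0,0,0,0,0,0,0,0,0,0,0,0,0],
     [0,1,0,0,0,0,0,0,0,0,0,0,0,0,0,0,0,0],
     [0,0,0,1,0,0,0,1,1,0,0,0,1,1,1,0,0,1],
     [1,1,0,1,0,1,1,1,1,1,1,0,0,0,1,0,0,1],
     [0,1,1,0,0,1,0,1,0,1,0,0,1,0,1,1,0,1],
     [0,1,1,0,1,1,1,0,1,0,0,0,0,0,0,1,0,0],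
     [1,0,0,1,0,0,0,1,1,0,1,0,0,0,0,0,1,1],
     [0,1,1,0,1,1,1,0,0,0,1,1,0,1,0,0,1,0],
     [1,1,1,1,0,0,0,0,1,0,1,1,0,0,1,0,1,0],
     [1,0,0,0,1,1,1,0,1,1,0,1,0,1,1,1,0,1],
     [0,1,1,1,1,0,1,1,0,1,1,0,0,1,0,0,0,0],
     [1,0,1,0,0,1,1,0,1,1,1,0,0,1,0,0,1,0],
     [1,0,0,0,1,0,0,0,0,0,0,1,1,0,1,1,0,1],
     [0,0,0,1,0,1,0,0,1,1,1,1,0,0,1,0,0,0],
     [1,0,0,1,0,1,1,0,1,1,0,1,0,0,0,1,1,0],
     [0,0,1,0,0,1,0,1,1,0,1,0,1,1,0,1,0,1],
     [1,1,1,1,1,1,0,0,0,1,0,1,1,0,1,1,0,0],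
     [0,1,0,1,0,1,0,1,0,0,1,0,1,0,1,0,0,0]]"

text \<open>The inverse of G G^T = I + A A^T, hence symmetric.\<close>

definition gram_inverse_34_16 :: "bit list list" where
  "gram_inverse_34_16 =
    [[0,0,0,0,0,0,1,0,1,1,1,1,1,0,0,1],
     [0,0,0,1,1,0,0,0,1,1,0,1,1,0,0,1],
     [0,0,0,0,1,1,1,1,1,0,0,0,0,0,0,1],
     [0,1,0,0,0,0,1,0,0,0,1,0,1,1,1,0],
     [0,1,1,0,0,0,0,0,1,0,0,1,1,0,0,0],
     [0,0,1,0,0,0,0,1,0,0,1,1,1,1,0,0],
     [1,0,1,1,0,0,0,1,1,1,1,0,1,1,0,0],
     [0,0,1,0,0,1,1,0,0,1,1,0,0,0,1,1],
     [1,1,1,0,1,0,1,0,0,1,0,1,1,0,1,0],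
     [1,1,0,0,0,0,1,1,1,0,1,0,1,1,1,1],
     [1,0,0,1,0,1,1,1,0,1,0,0,1,1,0,0],
     [1,1,0,0,1,1,0,0,1,0,0,0,1,0,1,1],
     [1,1,0,1,1,1,1,0,1,1,1,1,0,1,0,0],
     [0,0,0,1,0,1,1,0,0,1,1,0,1,0,1,1],
     [0,0,0,1,0,0,0,1,1,1,0,1,0,1,0,0],
     [1,1,1,0,0,0,0,1,0,1,0,1,0,1,0,0]]"

text \<open>Here \<open>h\<close> is n - 2k, so A has h + k = 18 columns. The first row of A has
  weight 7, which gives a generator row of weight 8; this is so for all six codes.\<close>

lemma certificate_34_16: "certificate 16 2 8 redundancy_34_16 decoder_34_16 gram_inverse_34_16"
  by code_simp

section \<open>The [37, 18, 8] code, with h = 1\<close>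

definition redundancy_37_18 :: "bit list list" where
  "redundancy_37_18 =
    [[0,0,0,0,0,0,0,0,0,0,0,0,1,1,1,1,1,1,1],
     [1,1,1,0,1,0,1,1,0,0,1,0,1,0,1,1,1,1,1],
     [1,1,0,1,1,0,0,0,0,0,1,0,1,0,1,0,0,1,1],
     [0,0,1,1,0,0,1,0,1,0,1,1,1,0,1,1,0,1,1],
     [1,0,0,1,0,1,0,0,0,1,0,0,1,0,1,1,1,0,1],
     [1,0,1,0,1,0,1,1,1,0,0,0,1,1,1,1,1,0,0],
     [1,0,0,0,1,1,1,1,1,0,0,1,0,0,1,1,1,1,0],
     [0,1,1,1,0,1,0,1,1,1,1,1,1,1,0,0,0,1,1],
     [0,0,0,0,1,1,0,0,0,0,1,1,1,0,0,0,0,1,1],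
     [0,0,0,1,0,0,0,1,0,1,0,0,1,0,0,0,1,1,1],
     [1,1,1,0,1,1,1,0,0,0,1,0,0,1,1,1,0,0,1],
     [0,1,0,1,1,0,0,1,0,1,0,0,1,1,1,0,0,1,0],
     [0,1,1,0,0,1,0,0,1,1,1,1,1,1,1,1,0,0,0],
     [1,1,0,0,0,1,1,1,1,0,0,1,1,1,1,1,1,0,1],
     [1,1,0,0,0,1,0,1,1,1,1,0,0,0,1,1,0,1,1],
     [0,0,0,0,1,0,1,1,1,0,1,0,1,0,0,1,1,1,0],
     [0,1,1,0,0,1,0,0,0,0,1,1,0,0,1,0,0,1,0],
     [1,0,0,1,0,1,1,1,1,0,0,0,1,0,1,0,0,1,0]]"

definition decoder_37_18 :: "bit list list" where
  "decoder_37_18 =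
    [[0,1,1,1,1,1,1,0,0,0,0,1,1,1,1,1,1,1,0],
     [0,1,0,1,1,1,1,0,0,1,1,1,1,1,1,0,1,0,1],
     [0,1,0,0,0,1,1,1,0,1,0,0,1,1,0,1,0,1,0],
     [0,0,1,0,1,0,0,0,1,1,1,0,0,1,0,1,0,0,0],
     [1,0,0,0,0,0,0,0,0,0,0,0,0,0,0,0,0,0,0],
     [0,0,1,1,0,1,0,0,1,1,0,1,1,0,1,1,1,1,0],
     [0,0,0,0,1,0,1,0,1,1,1,0,0,0,0,0,0,1,1],
     [0,0,1,0,1,1,1,1,0,1,0,0,0,1,0,0,0,0,0],
     [1,1,0,0,0,1,0,0,1,1,0,1,1,0,0,1,0,0,1],
     [1,0,0,0,0,1,0,1,0,1,0,1,1,1,1,0,1,0,0],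
     [0,1,1,1,1,1,0,1,0,1,0,1,1,1,0,1,0,0,0],
     [1,1,0,0,1,0,0,1,0,1,1,0,1,1,1,1,0,0,1],
     [0,0,0,1,1,0,1,0,1,0,0,0,0,1,1,0,0,0,1],
     [1,1,0,1,1,1,1,1,1,1,0,1,0,1,0,1,0,1,0],
     [1,1,1,0,0,1,0,1,0,1,1,1,0,0,0,0,1,0,0],
     [1,1,1,1,1,0,0,0,0,1,1,1,1,0,1,0,0,1,0],
     [1,0,0,0,0,0,1,0,0,1,1,1,0,1,1,0,0,1,1],
     [0,1,1,1,1,1,0,0,1,0,1,0,1,0,1,0,1,1,0],
     [0,1,1,0,0,1,1,0,1,0,0,0,0,1,0,1,0,0,0]]"

definition gram_inverse_37_18 :: "bit list list" where
  "gram_inverse_37_18 =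
    [[0,1,0,1,1,0,1,1,0,1,1,1,0,0,0,0,1,1],
     [1,0,0,0,0,0,1,0,1,0,1,0,1,0,0,0,1,1],
     [0,0,0,1,0,0,1,1,0,1,1,1,1,0,1,1,1,1],
     [1,0,1,0,1,1,0,0,1,0,0,0,0,1,1,0,1,1],
     [1,0,0,1,0,0,0,0,0,1,0,0,0,1,1,0,0,1],
     [0,0,0,1,0,0,0,0,1,0,0,1,0,1,0,1,0,0],
     [1,1,1,0,0,0,0,1,1,1,0,1,1,0,0,1,1,1],
     [1,0,1,0,0,0,1,0,1,0,0,1,1,0,0,0,1,1],
     [0,1,0,1,0,1,1,1,0,1,0,0,1,0,1,0,1,0],
     [1,0,1,0,1,0,1,0,1,0,1,1,1,0,0,0,0,0],
     [1,1,1,0,0,0,0,0,0,1,0,0,0,0,0,1,1,0],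
     [1,0,1,0,0,1,1,1,0,1,0,0,0,1,0,0,0,1],
     [0,1,1,0,0,0,1,1,1,1,0,0,0,0,1,0,1,1],
     [0,0,0,1,1,1,0,0,0,0,0,1,0,0,1,1,1,1],
     [0,0,1,1,1,0,0,0,1,0,0,0,1,1,0,0,0,1],
     [0,0,1,0,0,1,1,0,0,0,1,0,0,1,0,0,1,1],
     [1,1,1,1,0,0,1,1,1,0,1,0,1,1,0,1,0,0],
     [1,1,1,1,1,0,1,1,0,0,0,1,1,1,1,1,0,0]]"

lemma certificate_37_18: "certificate 18 1 8 redundancy_37_18 decoder_37_18 gram_inverse_37_18"
  by code_simp

section \<open>The [39, 18, 8] code, with h = 3\<close>

definition redundancy_39_18 :: "bit list list" where
  "redundancy_39_18 =
    [[0,0,0,0,0,0,0,0,0,0,0,0,0,0,1,1,1,1,1,1,1],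
     [1,1,0,1,1,1,1,1,0,0,0,1,1,1,0,1,1,0,0,0,0],
     [0,1,1,1,1,0,0,1,1,0,0,0,0,1,0,0,1,1,1,0,0],
     [1,1,0,1,0,0,1,0,0,1,1,0,0,0,0,0,1,1,1,1,1],
     [0,1,0,1,0,0,1,1,1,0,1,0,1,1,0,1,1,1,1,1,0],
     [1,1,1,0,0,1,1,1,1,1,1,1,1,0,0,1,1,1,1,0,1],
     [0,1,0,0,1,0,1,0,0,1,0,0,0,1,0,0,0,0,0,1,1],
     [0,0,1,1,1,1,0,0,1,0,0,0,1,0,0,0,0,0,0,1,1],
     [1,0,0,1,1,1,1,0,1,1,1,1,1,0,0,0,1,0,0,0,0],
     [1,1,1,0,0,1,0,1,0,0,1,0,0,0,1,1,1,1,1,0,0],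
     [0,1,0,0,0,0,1,0,0,1,0,0,0,0,1,1,1,0,0,0,1],
     [0,0,0,1,1,0,1,1,1,0,1,0,0,0,1,1,1,1,0,0,0],
     [1,0,0,1,1,1,1,0,1,1,0,0,1,1,1,0,0,1,0,0,0],
     [0,1,1,0,0,0,1,1,0,1,0,1,1,1,1,0,1,0,0,1,1],
     [1,1,1,0,1,1,0,0,0,1,1,0,1,0,0,1,0,0,1,0,1],
     [0,1,1,1,0,1,1,0,0,1,1,0,1,0,0,0,1,1,0,0,1],
     [0,1,1,1,1,0,1,0,0,0,0,1,0,1,1,1,1,1,0,0,0],
     [0,0,1,0,1,1,1,0,0,1,0,1,0,1,1,0,1,0,0,0,1]]"

definition decoder_39_18 :: "bit list list" where
  "decoder_39_18 =
    [[1,0,0,0,0,0,0,0,0,0,0,0,0,0,0,0,0,0,0,0,0],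
     [0,1,0,0,0,0,0,0,0,0,0,0,0,0,0,0,0,0,0,0,0],
     [0,1,0,0,0,0,1,0,0,0,0,1,1,1,0,1,1,0,1,0,0],
     [1,0,0,0,1,0,1,0,1,1,0,0,1,0,1,0,0,1,1,1,1],
     [0,0,0,1,1,0,0,1,0,0,0,0,0,1,0,1,0,0,1,0,1],
     [0,0,1,0,0,0,0,0,0,0,0,0,0,0,0,0,0,0,0,0,0],
     [0,0,1,0,0,1,0,1,1,1,0,1,0,0,1,1,0,1,1,0,0],
     [1,0,1,1,0,1,1,0,1,1,0,1,1,1,1,0,1,1,0,0,1],
     [0,0,1,1,1,0,1,1,1,1,0,0,1,1,0,1,0,1,1,1,1],
     [1,1,1,0,0,0,1,0,1,0,0,1,0,0,0,0,1,0,1,1,0],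
     [0,0,0,0,1,0,0,1,0,1,0,0,1,1,1,0,0,0,0,1,0],
     [0,0,0,1,0,1,0,1,1,1,0,0,0,0,0,1,1,0,0,1,0],
     [1,1,0,0,0,1,1,1,1,0,1,1,1,0,1,0,1,1,1,1,0],
     [1,0,0,1,0,0,1,1,1,0,0,0,0,0,1,1,1,0,0,0,0],
     [0,0,1,0,1,0,1,1,1,0,0,1,1,0,0,1,0,0,1,0,1],
     [1,0,1,1,1,1,0,1,0,1,0,1,1,1,1,0,1,0,0,1,0],
     [0,0,0,1,0,1,0,0,0,1,1,0,0,1,0,0,1,0,0,0,1],
     [1,0,1,1,0,0,0,0,1,1,1,0,0,0,0,0,1,0,1,0,0],
     [0,0,1,0,1,1,1,1,1,1,0,0,0,1,1,0,1,1,1,0,1],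
     [0,0,0,0,1,0,0,0,0,1,1,0,0,0,0,1,1,0,0,1,1],
     [0,0,0,0,0,1,0,1,1,1,1,0,0,1,0,0,1,1,1,0,0]]"

definition gram_inverse_39_18 :: "bit list list" where
  "gram_inverse_39_18 =
    [[0,0,0,1,0,1,0,0,1,1,0,1,1,1,1,1,1,1],
     [0,0,1,0,0,0,0,1,0,1,0,0,0,1,1,0,0,1],
     [0,1,1,0,1,0,1,1,0,1,1,0,0,1,1,1,1,1],
     [1,0,0,1,0,1,1,1,1,1,1,0,1,1,1,1,1,0],
     [0,0,1,0,0,0,0,1,0,0,0,0,0,0,0,1,0,0],
     [1,0,0,1,0,0,1,0,0,0,1,0,0,1,1,1,1,1],
     [0,0,1,1,0,1,0,0,0,0,1,0,1,1,1,1,0,1],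
     [0,1,1,1,1,0,0,0,1,1,0,0,0,0,1,0,0,0],
     [1,0,0,1,0,0,0,1,1,1,1,1,0,1,0,1,0,0],
     [1,1,1,1,0,0,0,1,1,1,0,0,1,1,1,0,1,1],
     [0,0,1,1,0,1,1,0,1,0,0,1,0,0,1,0,0,1],
     [1,0,0,0,0,0,0,0,1,0,1,0,1,1,0,0,1,1],
     [1,0,0,1,0,0,1,0,0,1,0,1,1,0,0,0,0,0],
     [1,1,1,1,0,1,1,0,1,1,0,1,0,1,1,0,0,0],
     [1,1,1,1,0,1,1,1,0,1,1,0,0,1,1,1,1,0],
     [1,0,1,1,1,1,1,0,1,0,0,0,0,0,1,1,0,1],
     [1,0,1,1,0,1,0,0,0,1,0,1,0,0,1,0,0,1],
     [1,1,1,0,0,1,1,0,0,1,1,1,0,0,0,1,1,0]]"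

lemma certificate_39_18: "certificate 18 3 8 redundancy_39_18 decoder_39_18 gram_inverse_39_18"
  by code_simp

section \<open>The [40, 17, 8] code, with h = 6\<close>

definition redundancy_40_17 :: "bit list list" where
  "redundancy_40_17 =
    [[0,0,0,0,0,0,0,0,0,0,0,0,0,0,0,0,1,1,1,1,1,1,1],
     [1,1,0,1,1,0,0,1,1,0,1,1,1,1,0,0,0,1,0,0,0,1,0],
     [1,1,0,0,1,1,0,1,1,1,1,1,1,1,1,0,1,0,1,1,0,0,1],
     [1,1,0,0,0,0,0,1,0,0,1,1,1,0,1,0,1,0,1,1,1,0,1],
     [0,1,1,1,1,1,0,0,0,0,1,1,1,1,0,0,0,1,0,1,0,0,1],
     [1,1,0,1,1,0,1,1,0,1,1,0,0,1,0,0,1,1,1,0,0,1,1],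
     [1,0,0,1,1,1,0,1,1,0,1,0,0,0,1,1,1,1,0,1,0,1,0],
     [1,0,1,0,0,1,1,0,0,1,1,0,1,0,0,0,0,0,1,1,1,0,1],
     [0,1,1,0,0,0,1,1,0,0,0,0,1,0,1,1,0,1,0,1,1,0,1],
     [0,1,0,1,1,1,0,1,1,1,1,1,0,0,0,1,1,0,1,0,0,1,1],
     [0,1,1,0,1,0,0,1,0,1,1,0,1,0,1,1,0,1,1,0,0,0,1],
     [0,0,1,1,1,1,0,1,0,1,0,1,0,0,0,0,1,0,0,1,1,1,0],
     [0,0,0,1,1,0,1,0,1,1,1,0,1,1,0,1,0,1,1,0,1,0,0],
     [1,1,1,0,0,0,0,1,1,1,0,1,1,1,0,0,0,0,1,0,0,1,1],
     [1,0,1,1,1,1,1,1,0,0,0,0,0,0,0,0,1,1,0,1,0,1,1],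
     [0,0,0,1,0,1,1,0,0,0,1,0,1,0,1,0,1,0,0,1,0,0,1],
     [1,0,0,0,0,0,1,1,1,1,0,1,1,0,1,1,1,1,0,0,0,0,0]]"

definition decoder_40_17 :: "bit list list" where
  "decoder_40_17 =
    [[1,0,0,0,0,0,0,0,0,0,0,0,0,0,0,0,0,0,0,0,0,0,0],
     [0,1,0,0,0,0,0,0,0,0,0,0,0,0,0,0,0,0,0,0,0,0,0],
     [0,0,1,0,0,0,0,0,0,0,0,0,0,0,0,0,0,0,0,0,0,0,0],
     [0,1,1,0,0,0,1,0,1,1,1,1,1,1,0,0,0,1,0,1,1,0,1],
     [0,0,0,1,0,0,0,0,0,0,0,0,0,0,0,0,0,0,0,0,0,0,0],
     [0,0,0,0,1,0,0,0,0,0,0,0,0,0,0,0,0,0,0,0,0,0,0],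
     [0,0,0,0,0,1,0,0,0,0,0,0,0,0,0,0,0,0,0,0,0,0,0],
     [1,0,1,0,0,1,0,1,0,1,0,0,0,0,0,1,1,0,1,0,0,1,1],
     [1,1,0,0,0,1,1,0,1,0,1,1,0,0,1,0,0,0,0,1,1,1,1],
     [1,0,1,0,0,0,1,0,0,1,1,0,0,0,0,0,1,0,0,1,0,1,1],
     [1,1,0,1,1,1,0,0,0,0,0,0,0,0,0,1,1,1,1,1,1,0,1],
     [0,1,1,1,0,0,1,0,0,1,0,0,0,0,0,0,0,0,0,0,1,1,0],
     [1,0,0,0,1,1,1,1,0,1,1,1,0,0,0,1,1,1,1,0,1,1,1],
     [1,0,0,1,1,0,0,1,0,1,1,0,0,1,0,0,1,1,1,0,0,0,0],
     [0,0,1,0,1,1,1,0,0,1,1,0,1,0,1,0,1,0,1,0,0,1,0],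
     [0,0,1,0,0,1,1,1,1,0,1,0,0,1,1,0,0,0,1,0,0,1,1],
     [0,0,1,1,0,1,1,1,0,1,0,0,1,1,1,1,1,0,0,1,1,0,0],
     [1,0,0,0,0,1,1,0,0,0,1,0,0,0,0,1,1,1,0,1,0,1,0],
     [1,0,0,1,1,1,0,0,1,1,0,0,1,0,1,1,1,0,0,1,1,1,0],
     [0,0,0,1,0,0,1,1,1,1,0,1,1,1,1,0,0,0,0,1,1,0,0],
     [1,1,1,0,0,1,0,1,0,1,1,1,0,1,1,0,0,1,1,0,1,0,0],
     [1,1,1,0,1,1,1,0,0,1,1,1,1,0,1,0,1,1,0,0,1,1,1],
     [0,0,1,1,0,1,1,1,0,1,1,1,0,1,1,1,0,1,1,0,1,1,1]]"

definition gram_inverse_40_17 :: "bit list list" where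
  "gram_inverse_40_17 =
    [[0,0,1,0,0,0,1,1,1,0,1,0,0,1,1,0,1],
     [0,1,1,1,0,1,1,0,0,1,0,1,1,0,1,0,0],
     [1,1,1,0,1,0,0,0,0,1,0,0,0,0,1,0,1],
     [0,1,0,1,1,0,1,1,1,0,0,0,0,0,0,0,1],
     [0,0,1,1,1,0,0,0,0,1,0,0,0,0,1,1,1],
     [0,1,0,0,0,0,0,1,0,1,0,0,0,0,0,0,1],
     [1,1,0,1,0,0,0,1,0,0,0,0,1,1,0,1,1],
     [1,0,0,1,0,1,1,0,0,0,0,0,1,0,1,0,1],
     [1,0,0,1,0,0,0,0,1,0,1,1,0,1,0,1,0],
     [0,1,1,0,1,1,0,0,0,1,0,0,1,0,1,0,1],
     [1,0,0,0,0,0,0,0,1,0,0,0,0,0,0,0,1],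
     [0,1,0,0,0,0,0,0,1,0,0,1,0,0,0,0,0],
     [0,1,0,0,0,0,1,1,0,1,0,0,0,1,1,0,0],
     [1,0,0,0,0,0,1,0,1,0,0,0,1,1,1,1,0],
     [1,1,1,0,1,0,0,1,0,1,0,0,1,1,1,0,1],
     [0,0,0,0,1,0,1,0,1,0,0,0,0,1,0,0,1],
     [1,0,1,1,1,1,1,1,0,1,1,0,0,0,1,1,1]]"

lemma certificate_40_17: "certificate 17 6 8 redundancy_40_17 decoder_40_17 gram_inverse_40_17"
  by code_simp

section \<open>The [40, 18, 8] code, with h = 4\<close>

definition redundancy_40_18 :: "bit list list" where
  "redundancy_40_18 =
    [[0,0,0,0,0,0,0,0,0,0,0,0,0,0,0,1,1,1,1,1,1,1],
     [0,0,1,1,1,1,0,1,1,1,1,0,0,1,1,0,1,1,1,0,0,0],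
     [0,0,0,1,0,0,1,0,1,0,1,1,0,0,0,0,0,1,1,1,0,0],
     [0,0,0,0,0,1,1,0,1,1,1,1,0,1,0,0,1,0,1,0,1,0],
     [0,1,1,1,1,1,0,1,0,1,0,0,0,1,0,0,1,1,0,1,0,0],
     [0,0,0,0,0,1,0,0,0,0,0,0,1,1,1,1,0,1,1,1,0,0],
     [1,0,1,0,1,1,1,1,0,1,0,0,1,1,1,0,0,0,1,1,1,0],
     [0,0,1,0,1,0,0,0,1,0,1,1,1,1,1,0,1,1,1,0,1,0],
     [1,1,0,1,0,0,0,1,0,1,0,1,0,0,1,0,0,1,1,1,1,1],
     [0,0,1,0,0,1,0,1,1,1,0,1,1,0,1,1,0,1,0,1,1,1],
     [1,1,1,0,1,0,1,0,1,1,1,0,0,0,0,1,0,1,0,0,1,1],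
     [0,0,0,1,0,0,0,0,1,1,1,1,1,1,1,1,1,0,0,1,0,1],
     [0,0,0,0,1,0,0,1,0,1,1,1,1,0,0,1,1,1,1,1,0,0],
     [0,1,1,0,0,0,0,0,0,0,0,0,0,1,1,1,0,1,0,0,0,1],
     [1,0,1,1,0,0,1,0,0,1,0,1,0,1,1,0,1,1,0,1,1,1],
     [0,1,1,0,0,1,1,1,1,1,0,1,1,1,0,1,1,0,0,1,0,0],
     [1,0,1,1,1,0,0,1,0,0,1,0,1,0,1,0,1,0,0,0,0,1],
     [1,0,1,1,1,0,0,1,1,1,0,1,1,1,0,0,1,1,0,1,0,0]]"

definition decoder_40_18 :: "bit list list" where
  "decoder_40_18 =
    [[1,0,0,0,0,0,0,0,0,0,0,0,0,0,0,0,0,0,0,0,0,0],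
     [0,1,0,0,0,0,0,0,0,0,0,0,0,0,0,0,0,0,0,0,0,0],
     [0,0,1,0,0,0,0,0,0,0,0,0,0,0,0,0,0,0,0,0,0,0],
     [0,0,0,1,0,0,0,0,0,0,0,0,0,0,0,0,0,0,0,0,0,0],
     [0,1,1,1,1,1,0,1,0,1,0,1,1,0,0,0,0,1,0,1,1,0],
     [1,1,1,0,0,0,1,1,0,1,0,0,0,0,1,1,1,1,0,1,1,1],
     [0,0,0,0,1,1,0,1,0,1,1,0,0,1,0,0,1,1,0,1,1,0],
     [1,0,0,0,0,1,0,1,1,1,0,1,1,0,1,0,1,1,0,0,1,0],
     [0,1,0,0,0,1,1,1,1,0,1,1,0,0,1,1,1,1,0,0,1,1],
     [1,0,0,0,1,1,0,1,1,1,1,1,1,0,1,1,1,0,0,1,0,0],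
     [1,0,1,0,1,0,0,1,0,1,1,0,0,1,1,1,0,1,1,0,0,0],
     [1,1,1,1,1,1,1,1,1,0,1,1,1,1,0,0,1,0,0,1,1,0],
     [1,0,0,1,1,0,1,1,1,1,0,0,1,1,0,0,1,0,0,0,1,1],
     [1,0,0,1,0,0,0,1,1,1,1,0,0,1,0,0,1,0,1,1,0,1],
     [1,0,0,1,1,0,0,1,1,1,1,1,0,1,1,1,1,1,0,1,1,0],
     [0,1,1,1,1,1,1,0,1,1,0,1,0,0,0,0,1,1,0,1,0,0],
     [1,1,0,0,1,0,0,0,1,0,1,1,0,0,1,0,1,1,0,0,1,0],
     [0,0,1,1,1,1,0,1,1,0,1,0,1,1,1,1,1,0,0,1,1,0],
     [1,0,1,1,0,0,0,1,1,1,1,0,0,0,0,0,0,1,0,0,1,1],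
     [1,0,0,0,0,0,1,0,0,1,0,0,0,0,1,1,0,0,1,1,1,0],
     [1,0,0,1,1,0,1,1,0,0,0,0,0,0,1,0,1,0,0,1,0,0],
     [0,0,1,0,1,0,1,1,0,1,1,0,1,1,0,0,0,1,1,0,0,1]]"

definition gram_inverse_40_18 :: "bit list list" where
  "gram_inverse_40_18 =
    [[1,1,0,0,1,0,0,0,0,1,0,0,0,0,1,1,1,0],
     [1,0,0,0,0,0,1,1,1,1,0,0,0,1,0,1,0,1],
     [0,0,1,1,1,1,0,0,0,1,1,0,0,0,1,1,1,0],
     [0,0,1,0,1,1,1,1,0,1,1,0,0,1,0,1,0,0],
     [1,0,1,1,1,0,1,0,0,0,0,0,1,1,1,1,1,0],
     [0,0,1,1,0,0,1,1,0,1,0,1,0,1,0,1,0,0],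
     [0,1,0,1,1,1,0,0,0,1,1,1,1,1,1,1,0,0],
     [0,1,0,1,0,1,0,0,1,1,0,1,1,0,0,1,0,0],
     [0,1,0,0,0,0,0,1,1,1,1,1,0,1,1,1,1,0],
     [1,1,1,1,0,1,1,1,1,1,0,0,1,0,1,0,0,0],
     [0,0,1,1,0,0,1,0,1,0,1,1,0,1,1,1,0,1],
     [0,0,0,0,0,1,1,1,1,0,1,1,0,1,1,1,0,1],
     [0,0,0,0,1,0,1,1,0,1,0,0,1,0,1,0,0,1],
     [0,1,0,1,1,1,1,0,1,0,1,1,0,1,1,0,0,1],
     [1,0,1,0,1,0,1,0,1,1,1,1,1,1,1,1,1,1],
     [1,1,1,1,1,1,1,1,1,0,1,1,0,0,1,0,1,1],
     [1,0,1,0,1,0,0,0,1,0,0,0,0,0,1,1,0,1],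
     [0,1,0,0,0,0,0,0,0,0,1,1,1,1,1,1,1,1]]"

lemma certificate_40_18: "certificate 18 4 8 redundancy_40_18 decoder_40_18 gram_inverse_40_18"
  by code_simp

section \<open>The [40, 19, 8] code, with h = 2\<close>

definition redundancy_40_19 :: "bit list list" where
  "redundancy_40_19 =
    [[0,0,0,0,0,0,0,0,0,0,0,0,0,0,1,1,1,1,1,1,1],
     [1,0,0,1,0,0,0,1,0,0,1,1,1,1,1,0,0,1,1,0,1],
     [0,1,1,1,0,1,0,1,1,1,0,1,0,0,0,0,0,0,1,1,1],
     [0,0,1,1,1,1,0,1,0,0,0,0,1,1,0,0,0,0,0,0,0],
     [1,1,0,0,0,0,1,1,1,1,1,0,1,1,1,0,1,1,1,0,0],
     [0,1,1,1,0,1,1,0,0,0,0,1,0,1,0,1,0,1,0,1,0],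
     [0,1,0,1,1,0,1,1,1,0,1,1,1,0,0,0,1,0,1,0,1],
     [0,1,0,1,1,0,1,0,1,1,0,0,1,0,1,0,0,0,0,1,0],
     [1,0,0,0,1,0,1,1,1,1,0,1,0,0,0,0,1,0,0,1,1],
     [1,0,1,1,1,0,1,0,0,1,0,1,1,1,1,1,0,0,1,1,1],
     [0,1,0,1,0,1,0,1,0,0,0,0,0,1,0,0,0,1,0,0,1],
     [1,1,1,0,0,1,0,1,1,1,1,1,1,0,1,0,1,1,0,1,1],
     [1,1,0,0,0,1,1,0,0,0,1,1,0,1,0,1,0,1,1,0,0],
     [1,0,1,0,1,0,0,1,0,0,1,1,1,0,1,0,1,1,1,1,0],
     [0,0,1,0,1,1,0,0,0,0,1,0,1,1,1,0,1,0,0,0,1],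
     [1,1,1,1,0,0,1,1,0,1,1,0,0,0,1,0,1,1,0,0,1],
     [0,1,1,0,1,1,0,1,1,0,0,0,0,0,1,1,1,0,1,1,1],
     [1,1,0,0,0,0,0,1,1,0,0,1,0,0,0,0,1,0,1,0,1],
     [0,0,0,0,0,0,0,0,0,1,1,1,1,0,0,1,0,0,1,1,1]]"

definition decoder_40_19 :: "bit list list" where
  "decoder_40_19 =
    [[1,0,0,0,0,0,0,0,0,0,0,0,0,0,0,0,0,0,0,0,0],
     [1,0,1,0,1,1,0,1,1,0,1,0,0,0,1,1,1,0,1,0,0],
     [1,0,1,1,1,0,0,0,0,0,0,1,1,0,1,0,0,0,1,0,0],
     [1,0,0,0,1,1,0,1,0,1,0,0,1,1,0,1,1,0,0,1,1],
     [1,0,0,1,1,1,0,0,1,1,0,0,0,1,1,0,1,1,1,1,0],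
     [0,1,0,0,0,0,0,0,0,0,0,0,0,0,0,0,0,0,0,0,0],
     [0,0,1,1,0,1,1,1,0,1,0,1,0,1,0,0,1,1,0,1,1],
     [1,0,0,0,0,0,1,0,1,1,0,0,1,1,0,0,0,1,0,0,0],
     [1,1,1,0,0,1,0,0,0,0,1,1,0,1,0,0,0,0,1,0,1],
     [0,0,1,0,1,0,0,1,0,1,1,0,1,0,1,0,1,0,1,0,0],
     [1,0,0,1,1,0,1,1,0,0,1,0,1,1,1,0,1,0,0,0,0],
     [1,0,0,0,1,1,1,1,1,0,0,1,1,1,0,0,1,0,0,0,0],
     [0,0,1,1,1,1,0,1,0,1,1,1,0,0,0,1,0,0,1,0,0],
     [0,1,0,1,0,0,1,0,0,0,1,0,1,1,0,0,0,0,1,0,1],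
     [1,1,0,1,0,1,1,1,1,1,0,1,0,1,1,1,0,0,1,1,0],
     [0,0,0,1,0,0,0,0,0,1,0,1,0,0,1,1,1,1,0,1,1],
     [0,1,1,1,1,0,0,0,1,1,1,1,1,0,0,1,1,0,0,0,0],
     [1,0,0,0,1,1,1,1,1,0,0,0,0,1,1,1,0,0,1,1,1],
     [1,0,0,0,0,0,1,1,1,0,1,1,1,1,1,1,1,0,1,1,0],
     [1,0,1,0,1,1,0,0,1,1,0,0,0,1,0,0,1,0,0,0,1],
     [0,0,1,1,1,1,1,1,1,0,0,0,0,0,0,1,0,1,1,0,1]]"

definition gram_inverse_40_19 :: "bit list list" where
  "gram_inverse_40_19 =
    [[1,0,1,0,1,1,1,1,0,0,1,0,0,1,0,1,0,1,0],
     [0,1,0,0,1,1,0,1,1,1,1,0,1,0,1,1,1,1,0],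
     [1,0,1,1,0,1,1,0,1,1,1,0,1,1,0,0,0,1,0],
     [0,0,1,1,0,1,0,0,1,0,0,1,1,0,1,0,0,0,0],
     [1,1,0,0,0,1,0,1,1,1,1,1,0,1,1,1,1,0,0],
     [1,1,1,1,1,1,0,1,0,0,0,1,0,1,1,1,0,1,1],
     [1,0,1,0,0,0,0,1,0,0,1,0,1,0,1,1,1,1,0],
     [1,1,0,0,1,1,1,1,0,1,1,0,1,1,0,0,1,1,0],
     [0,1,1,1,1,0,0,0,1,1,1,1,0,1,1,0,1,0,1],
     [0,1,1,0,1,0,0,1,1,0,0,0,0,1,0,1,0,1,0],
     [1,1,1,0,1,0,1,1,1,0,1,1,0,1,0,1,0,1,0],
     [0,0,0,1,1,1,0,0,1,0,1,0,1,0,1,1,1,0,1],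
     [0,1,1,1,0,0,1,1,0,0,0,1,1,0,1,0,1,1,1],
     [1,0,1,0,1,1,0,1,1,1,1,0,0,0,1,1,1,1,0],
     [0,1,0,1,1,1,1,0,1,0,0,1,1,1,0,0,0,0,1],
     [1,1,0,0,1,1,1,0,0,1,1,1,0,1,0,1,1,1,0],
     [0,1,0,0,1,0,1,1,1,0,0,1,1,1,0,1,1,1,0],
     [1,1,1,0,0,1,1,1,0,1,1,0,1,1,0,1,1,0,1],
     [0,0,0,0,0,1,0,0,1,0,0,1,1,0,1,0,0,1,0]]"

lemma certificate_40_19: "certificate 19 2 8 redundancy_40_19 decoder_40_19 gram_inverse_40_19"
  by code_simp

theorem corollary4p8:
  shows "\<forall>(n, k) \<in> {(34, 16), (37, 18), (39, 18), (40, 17), (40, 18), (40, 19)}.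
           \<exists>C. binary_code n k 8 C \<and> LCD_code n C"
  \<comment> \<open>Each instance has length k + (h + k), which evaluates to the required n, as in
    16 + (2 + 16) = 34.\<close>
  using certificate_34_16[THEN certificate_imp_LCD_code]
    certificate_37_18[THEN certificate_imp_LCD_code]
    certificate_39_18[THEN certificate_imp_LCD_code]
    certificate_40_17[THEN certificate_imp_LCD_code]
    certificate_40_18[THEN certificate_imp_LCD_code]
    certificate_40_19[THEN certificate_imp_LCD_code]
  by simp

end
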